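(* (a) The only integer matrices in $P(m,n)$ are the $m\times n$ sign matrices. (b) For a partition $\lambda$ and positive integer $n$, the only integer matrices in $P(\lambda,n)$ are the matrices in $M(\lambda,n)$. (c) The only integer matrices in $ASM_n$ are the $n\times n$ alternating sign matrices.
   Context: A sign matrix is a matrix with entries in $\{-1,0,1\}$ whose column partial sums from the top lie in $\{0,1\}$ and whose row partial sums from the left are nonnegative; $P(m,n)$ is the convex hull in $\mathbb{R}^{mn}$ of all $m\times n$ sign matrices. For a partition $\lambda=[\lambda_1,\ldots,\lambda_k]$ with $a_i$ the number of parts equal to $i$, $M(\lambda,n)$ is the set of $\lambda_1\times n$ sign matrices whose $i$-th row sums to $a_{\lambda_1-i+1}$, and $P(\lambda,n)$ is its convex hull in $\mathbb{R}^{\lambda_1 n}$. An alternating sign matrix is a square matrix with entries in $\{-1,0,1\}$ whose rows and columns each sum to $1$ and whose nonzero entries alternate in sign along every row and column; $ASM_n$ is the convex hull in $\mathbb{R}^{n^2}$ of all $n\times n$ alternating sign matrices. *)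

theory Defs
  imports "HOL-Analysis.Analysis" "HOL-Library.Function_Algebras"
begin

text \<open>
  Matrix dimensions have to be terms here (the number of rows of a matrix in
  \<open>M(\<lambda>,n)\<close> is the largest part of \<open>\<lambda>\<close>), so an \<open>m \<times> n\<close> real matrix is a function
  \<open>nat \<Rightarrow> nat \<Rightarrow> real\<close>, with rows \<open>1..m\<close> counted from the top and columns \<open>1..n\<close> counted
  from the left, that vanishes outside this index range. These functions form a copy of
  \<open>\<real>\<^sup>m\<^sup>n\<close> inside the function space. The pointwise real vector space structure
  below makes the library's \<open>convex hull\<close> available for sets of such matrices.
\<close>

instantiation "fun" :: (type, real_vector) real_vector
begin

definition scaleR_fun :: "real \<Rightarrow> ('a \<Rightarrow> 'b) \<Rightarrow> 'a \<Rightarrow> 'b"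
  where "scaleR_fun r f = (\<lambda>x. r *\<^sub>R f x)"

instance
  by standard (simp_all add: scaleR_fun_def fun_eq_iff scaleR_add_right scaleR_add_left)

end

type_synonym matrix = "nat \<Rightarrow> nat \<Rightarrow> real"

definition is_matrix :: "nat \<Rightarrow> nat \<Rightarrow> matrix \<Rightarrow> bool"
  where "is_matrix m n A \<longleftrightarrow> (\<forall>i j. \<not> (i \<in> {1..m} \<and> j \<in> {1..n}) \<longrightarrow> A i j = 0)"

definition integer_matrix :: "nat \<Rightarrow> nat \<Rightarrow> matrix \<Rightarrow> bool"
  where "integer_matrix m n A \<longleftrightarrow>
    is_matrix m n A \<and> (\<forall>i\<in>{1..m}. \<forall>j\<in>{1..n}. A i j \<in> \<int>)"

definition sign_matrices :: "nat \<Rightarrow> nat \<Rightarrow> matrix set"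
  where "sign_matrices m n = {A. is_matrix m n A \<and>
    (\<forall>i\<in>{1..m}. \<forall>j\<in>{1..n}. A i j \<in> {-1, 0, 1}) \<and>
    (\<forall>i\<in>{1..m}. \<forall>j\<in>{1..n}. (\<Sum>i'=1..i. A i' j) \<in> {0, 1}) \<and>
    (\<forall>i\<in>{1..m}. \<forall>j\<in>{1..n}. (\<Sum>j'=1..j. A i j') \<ge> 0)}"

definition sign_matrix_polytope :: "nat \<Rightarrow> nat \<Rightarrow> matrix set"
  where "sign_matrix_polytope m n = convex hull (sign_matrices m n)"

definition is_partition :: "nat list \<Rightarrow> bool"
  where "is_partition p \<longleftrightarrow> sorted_wrt (\<ge>) p \<and> (\<forall>x\<in>set p. 0 < x)"

text \<open>The first part \<open>\<lambda>\<^sub>1\<close>, read as \<open>0\<close> for the empty partition.\<close>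

definition first_part :: "nat list \<Rightarrow> nat"
  where "first_part p = (case p of [] \<Rightarrow> 0 | x # _ \<Rightarrow> x)"

text \<open>\<open>count_list p k\<close> is \<open>a\<^sub>k\<close>, the number of parts of \<open>p\<close> equal to \<open>k\<close>.\<close>

definition partition_sign_matrices :: "nat list \<Rightarrow> nat \<Rightarrow> matrix set"
  where "partition_sign_matrices p n = {A \<in> sign_matrices (first_part p) n.
    \<forall>i\<in>{1..first_part p}. (\<Sum>j=1..n. A i j) = real (count_list p (first_part p - i + 1))}"

definition partition_polytope :: "nat list \<Rightarrow> nat \<Rightarrow> matrix set"
  where "partition_polytope p n = convex hull (partition_sign_matrices p n)"

text \<open>Any two consecutive nonzero terms of \<open>f 1, \<dots>, f n\<close> have opposite signs.\<close>

definition alternating_signs :: "nat \<Rightarrow> (nat \<Rightarrow> real) \<Rightarrow> bool"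
  where "alternating_signs n f \<longleftrightarrow>
    (\<forall>k\<in>{1..n}. \<forall>l\<in>{1..n}. k < l \<and> f k \<noteq> 0 \<and> f l \<noteq> 0 \<and> (\<forall>q\<in>{k<..<l}. f q = 0)
      \<longrightarrow> sgn (f l) = - sgn (f k))"

definition alternating_sign_matrices :: "nat \<Rightarrow> matrix set"
  where "alternating_sign_matrices n = {A. is_matrix n n A \<and>
    (\<forall>i\<in>{1..n}. \<forall>j\<in>{1..n}. A i j \<in> {-1, 0, 1}) \<and>
    (\<forall>i\<in>{1..n}. (\<Sum>j=1..n. A i j) = 1) \<and>
    (\<forall>j\<in>{1..n}. (\<Sum>i=1..n. A i j) = 1) \<and>
    (\<forall>i\<in>{1..n}. alternating_signs n (\<lambda>j. A i j)) \<and>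
    (\<forall>j\<in>{1..n}. alternating_signs n (\<lambda>i. A i j))}"

definition asm_polytope :: "nat \<Rightarrow> matrix set"
  where "asm_polytope n = convex hull (alternating_sign_matrices n)"

end

theory Submission
  imports Defs
begin

text \<open>
  In each of the three cases the matrices are exactly the integer matrices satisfying a system of
  linear inequalities, and a system of linear inequalities passes to the convex hull. For sign
  matrices, an integer column partial sum in \<open>[0,1]\<close> is \<open>0\<close> or \<open>1\<close>, and each entry, as a difference
  of two such sums, is in \<open>{-1,0,1}\<close>. For alternating sign matrices, the alternation condition
  together with the total \<open>1\<close> amounts to all row and column partial sums lying in \<open>{0,1}\<close>.
\<close>

lemma linear_image_convex_hull_subset:
  assumes "linear L" and "convex C" and "\<And>x. x \<in> S \<Longrightarrow> L x \<in> C" and "x \<in> convex hull S"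
  shows "L x \<in> C"
proof -
  have "L x \<in> convex hull (L ` S)"
    using assms(1,4) by (metis convex_hull_linear_image imageI)
  also have "\<dots> \<subseteq> C"
    using assms(2,3) by (intro hull_minimal) auto
  finally show ?thesis .
qed

lemma linear_column_sum: "linear (\<lambda>A :: matrix. \<Sum>i\<in>I. A i j)"
  by (rule linearI) (simp_all add: scaleR_fun_def sum.distrib sum_distrib_left)

lemma linear_row_sum: "linear (\<lambda>A :: matrix. \<Sum>j\<in>J. A i j)"
  by (rule linearI) (simp_all add: scaleR_fun_def sum.distrib sum_distrib_left)

lemma Ints_unit_interval: "x \<in> \<int> \<Longrightarrow> x \<in> {0..1} \<Longrightarrow> x \<in> {0, 1 :: real}"
  by (elim Ints_cases) auto

lemma entry_from_partial_sums:
  fixes f :: "nat \<Rightarrow> real"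
  assumes "\<And>k. k \<in> {1..n} \<Longrightarrow> (\<Sum>i=1..k. f i) \<in> {0, 1}" and "k \<in> {1..n}"
  shows "f k \<in> {-1, 0, 1}"
proof -
  obtain l where k: "k = Suc l" using assms(2) by (cases k) auto
  \<comment> \<open>The hypothesis starts at index 1; for \<open>l = 0\<close> the empty sum
    supplies the value 0.\<close>
  have "(\<Sum>i=1..l. f i) \<in> {0, 1}"
    using assms k by (cases "l = 0") auto
  moreover have "(\<Sum>i=1..l. f i) + f k \<in> {0, 1}"
    using assms(1)[OF assms(2)] by (simp add: k)
  ultimately show ?thesis by auto
qed

text \<open>By alternation the nonzero terms are c, -c, c, ..., so the partial sums take only the
  values 0 and c. The total 1 forces c = 1.\<close>

lemma alternating_partial_sums:
  assumes alt: "alternating_signs n f" and val: "\<And>i. i \<in> {1..n} \<Longrightarrow> f i \<in> {-1, 0, 1}"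
    and total: "(\<Sum>i=1..n. f i) = 1" and k: "k \<in> {1..n}"
  shows "(\<Sum>i=1..k. f i) \<in> {0, 1}"
proof -
  have "\<exists>p. p \<in> {1..n} \<and> f p \<noteq> 0"
    using total by (metis sum.neutral zero_neq_one)
  then obtain p where p: "p \<in> {1..n}" "f p \<noteq> 0" and least: "\<And>i. i < p \<Longrightarrow> i \<in> {1..n} \<Longrightarrow> f i = 0"
    using exists_least_iff[of "\<lambda>p. p \<in> {1..n} \<and> f p \<noteq> 0"] by blast
  \<comment> \<open>With \<open>q\<close> the last nonzero position up to \<open>l\<close>, the partial sum is \<open>f p\<close> or \<open>0\<close> according to
    whether \<open>f q = f p\<close> or \<open>f q = - f p\<close>.\<close>
  have inv: "(l < p \<and> (\<Sum>i=1..l. f i) = 0) \<or>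
      (\<exists>q\<in>{1..l}. f q \<noteq> 0 \<and> (\<forall>i\<in>{q<..l}. f i = 0) \<and> (\<Sum>i=1..l. f i) = (f q + f p) / 2)"
    if "l \<le> n" for l
    using that
  proof (induction l)
    case 0
    then show ?case using p by auto
  next
    case (Suc l)
    then consider (before) "l < p" "(\<Sum>i=1..l. f i) = 0"
      | (after) q where "q \<in> {1..l}" "f q \<noteq> 0" "\<forall>i\<in>{q<..l}. f i = 0"
          "(\<Sum>i=1..l. f i) = (f q + f p) / 2"
      by auto
    then show ?case
    proof cases
      case before
      show ?thesis
      proof (cases "Suc l = p")
        case True
        then show ?thesis using before p by (intro disjI2 bexI[of _ p]) auto
      next
        case False
        then show ?thesis using before least[of "Suc l"] Suc.prems by auto
      qed
    next
      case after
      show ?thesis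
      proof (cases "f (Suc l) = 0")
        case True
        then show ?thesis
          using after by (intro disjI2 bexI[of _ q]) (auto simp: le_Suc_eq)
      next
        case False
        have "\<forall>i\<in>{q<..<Suc l}. f i = 0" using after by auto
        then have "sgn (f (Suc l)) = - sgn (f q)"
          using alt after False Suc.prems unfolding alternating_signs_def by auto
        then have "f (Suc l) = - f q"
          using val[of q] val[of "Suc l"] after Suc.prems by auto
        \<comment> \<open>Adding \<open>- f q\<close> to \<open>(f q + f p) / 2\<close> gives
          \<open>(f p - f q) / 2\<close>, the same formula with \<open>Suc l\<close> as last nonzero
          position.\<close>
        then show ?thesis
          using after False by (intro disjI2 bexI[of _ "Suc l"]) (auto simp: field_simps)
      qed
    qed
  qed
  have "f p = 1"
  proof -
    \<comment> \<open>The first alternative of \<open>inv\<close> would make the total 0. In the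
      second, two entries that are at most 1 add up to 2, so both equal 1.\<close>
    obtain q where "q \<in> {1..n}" "f q + f p = 2"
      using inv[of n] total by auto
    then show ?thesis using val[of q] val[of p] p by auto
  qed
  from inv[of k] k consider "(\<Sum>i=1..k. f i) = 0"
    | q where "q \<in> {1..n}" "f q \<noteq> 0" "(\<Sum>i=1..k. f i) = (f q + f p) / 2" by fastforce
  then show ?thesis
  proof cases
    case (2 q)
    then show ?thesis using val[OF \<open>q \<in> {1..n}\<close>] \<open>f p = 1\<close> by auto
  qed simp
qed

text \<open>The partial sums walk on {0, 1}: a nonzero term moves the walk up or down by 1, zeros
  leave it in place, so the next nonzero term must move it back.\<close>

lemma partial_sums_alternating:
  assumes part: "\<And>k. k \<in> {1..n} \<Longrightarrow> (\<Sum>i=1..k. f i) \<in> {0, 1}"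
  shows "alternating_signs n f"
  unfolding alternating_signs_def
proof (intro ballI impI)
  fix k l
  assume k: "k \<in> {1..n}" and l: "l \<in> {1..n}"
    and kl: "k < l \<and> f k \<noteq> 0 \<and> f l \<noteq> 0 \<and> (\<forall>q\<in>{k<..<l}. f q = 0)"
  have split: "(\<Sum>i=1..b. f i) = (\<Sum>i=1..<b. f i) + f b" if "b \<in> {1..n}" for b
    using that by (simp add: sum.last_plus add.commute)
  have part': "(\<Sum>i=1..<b. f i) \<in> {0, 1}" if "b \<in> {1..n}" for b
  proof (cases "b = 1")
    case False
    then have "{1..<b} = {1..b-1}" "b - 1 \<in> {1..n}" using that by auto
    then show ?thesis using part by metis
  qed simp
  \<comment> \<open>Only zeros lie strictly between \<open>k\<close> and \<open>l\<close>, so just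
    before \<open>l\<close> the walk is still where it arrived at \<open>k\<close>.\<close>
  have "(\<Sum>i=1..<l. f i) = (\<Sum>i=1..k. f i)"
    using kl k by (intro sum.mono_neutral_right) auto
  then show "sgn (f l) = - sgn (f k)"
    using split[OF k] split[OF l] part[OF k] part[OF l] part'[OF k] kl by auto
qed

text \<open>Allowing any \<open>S\<close> inside \<open>sign_matrices m n\<close> lets P(m,n) and
  P(\<lambda>,n) share the argument.\<close>

lemma sign_matrix_polytope_bounds:
  assumes "A \<in> convex hull S" and "S \<subseteq> sign_matrices m n" and "i \<in> {1..m}" and "j \<in> {1..n}"
  shows "(\<Sum>i'=1..i. A i' j) \<in> {0..1}" and "(\<Sum>j'=1..j. A i j') \<in> {0..}"
proof -
  show "(\<Sum>i'=1..i. A i' j) \<in> {0..1}"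
  proof (rule linear_image_convex_hull_subset[OF linear_column_sum _ _ assms(1)])
    fix B assume "B \<in> S"
    then have "B \<in> sign_matrices m n" using assms(2) by blast
    then have "(\<Sum>i'=1..i. B i' j) \<in> {0, 1}" using assms(3,4) unfolding sign_matrices_def by blast
    then show "(\<Sum>i'=1..i. B i' j) \<in> {0..1}" by auto
  qed simp
  show "(\<Sum>j'=1..j. A i j') \<in> {0..}"
  proof (rule linear_image_convex_hull_subset[OF linear_row_sum _ _ assms(1)])
    fix B assume "B \<in> S"
    then have "B \<in> sign_matrices m n" using assms(2) by blast
    then show "(\<Sum>j'=1..j. B i j') \<in> {0..}" using assms(3,4) unfolding sign_matrices_def by auto
  qed simp
qed

text \<open>Integrality sharpens the column bounds from [0,1] to {0,1}; the row condition is an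
  inequality and carries over from the hull as it stands.\<close>

lemma integer_matrix_in_hull_sign:
  assumes "A \<in> convex hull S" and "S \<subseteq> sign_matrices m n" and "integer_matrix m n A"
  shows "A \<in> sign_matrices m n"
proof -
  have col: "(\<Sum>i'=1..i. A i' j) \<in> {0, 1}" if "i \<in> {1..m}" "j \<in> {1..n}" for i j
  proof (rule Ints_unit_interval)
    show "(\<Sum>i'=1..i. A i' j) \<in> \<int>"
      using assms(3) that by (intro Ints_sum) (auto simp: integer_matrix_def)
  qed (rule sign_matrix_polytope_bounds(1)[OF assms(1,2) that])
  have "A i j \<in> {-1, 0, 1}" if "i \<in> {1..m}" "j \<in> {1..n}" for i j
    using entry_from_partial_sums[of m "\<lambda>i. A i j"] col that by blast
  moreover have "(\<Sum>j'=1..j. A i j') \<ge> 0" if "i \<in> {1..m}" "j \<in> {1..n}" for i j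
    using sign_matrix_polytope_bounds(2)[OF assms(1,2) that] by simp
  ultimately show ?thesis
    using col assms(3) unfolding sign_matrices_def integer_matrix_def by blast
qed

lemma integer_matrixI:
  assumes "is_matrix m n A" and "\<And>i j. i \<in> {1..m} \<Longrightarrow> j \<in> {1..n} \<Longrightarrow> A i j \<in> {-1, 0, 1}"
  shows "integer_matrix m n A"
  unfolding integer_matrix_def
proof (intro conjI ballI)
  fix i j assume "i \<in> {1..m}" "j \<in> {1..n}"
  from assms(2)[OF this] show "A i j \<in> \<int>" by auto
qed (fact assms(1))

lemma sign_matrix_integer: "A \<in> sign_matrices m n \<Longrightarrow> integer_matrix m n A"
  by (rule integer_matrixI) (auto simp: sign_matrices_def)

text \<open>A prescribed row sum is a linear equation, and the singleton of its value is
  convex.\<close>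

lemma partition_polytope_row_sum:
  assumes "A \<in> partition_polytope p n" and "i \<in> {1..first_part p}"
  shows "(\<Sum>j=1..n. A i j) = real (count_list p (first_part p - i + 1))"
proof -
  have "(\<Sum>j=1..n. A i j) \<in> {real (count_list p (first_part p - i + 1))}"
    by (rule linear_image_convex_hull_subset[OF linear_row_sum, where S = "partition_sign_matrices p n"])
      (use assms in \<open>auto simp: partition_polytope_def partition_sign_matrices_def\<close>)
  then show ?thesis by simp
qed

text \<open>Alternation of signs is not a linear condition. This form replaces it by conditions on
  partial sums, which relax to linear inequalities valid on the hull.\<close>

lemma alternating_sign_matrices_iff:
  "A \<in> alternating_sign_matrices n \<longleftrightarrow> is_matrix n n A \<and>
    (\<forall>i\<in>{1..n}. \<forall>j\<in>{1..n}. (\<Sum>i'=1..i. A i' j) \<in> {0, 1}) \<and>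
    (\<forall>i\<in>{1..n}. \<forall>j\<in>{1..n}. (\<Sum>j'=1..j. A i j') \<in> {0, 1}) \<and>
    (\<forall>i\<in>{1..n}. (\<Sum>j=1..n. A i j) = 1) \<and> (\<forall>j\<in>{1..n}. (\<Sum>i=1..n. A i j) = 1)"
  (is "?L \<longleftrightarrow> ?R")
proof
  assume L: ?L
  have "(\<Sum>i'=1..i. A i' j) \<in> {0, 1}" if "i \<in> {1..n}" "j \<in> {1..n}" for i j
    by (rule alternating_partial_sums[of n]) (use L that in \<open>auto simp: alternating_sign_matrices_def\<close>)
  moreover have "(\<Sum>j'=1..j. A i j') \<in> {0, 1}" if "i \<in> {1..n}" "j \<in> {1..n}" for i j
    by (rule alternating_partial_sums[of n]) (use L that in \<open>auto simp: alternating_sign_matrices_def\<close>)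
  ultimately show ?R
    using L unfolding alternating_sign_matrices_def by blast
next
  assume R: ?R
  have "A i j \<in> {-1, 0, 1}" if "i \<in> {1..n}" "j \<in> {1..n}" for i j
    using entry_from_partial_sums[of n "\<lambda>i. A i j"] R that by blast
  moreover have "alternating_signs n (\<lambda>j. A i j)" if "i \<in> {1..n}" for i
    using partial_sums_alternating[of n "\<lambda>j. A i j"] R that by blast
  moreover have "alternating_signs n (\<lambda>i. A i j)" if "j \<in> {1..n}" for j
    using partial_sums_alternating[of n "\<lambda>i. A i j"] R that by blast
  ultimately show ?L
    using R unfolding alternating_sign_matrices_def by blast
qed

lemma alternating_sign_matrix_integer: "A \<in> alternating_sign_matrices n \<Longrightarrow> integer_matrix n n A"
  by (rule integer_matrixI) (auto simp: alternating_sign_matrices_def)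

text \<open>Since {0,1} is not convex, only the bounds [0,1] on partial sums reach the hull, and
  integrality recovers the two values. The totals, being equations, survive exactly.\<close>

lemma integer_matrix_in_asm_polytope:
  assumes "A \<in> asm_polytope n" and "integer_matrix n n A"
  shows "A \<in> alternating_sign_matrices n"
proof -
  have hull: "A \<in> convex hull alternating_sign_matrices n"
    using assms(1) by (simp add: asm_polytope_def)
  have "(\<Sum>i'=1..i. A i' j) \<in> {0, 1}" if "i \<in> {1..n}" "j \<in> {1..n}" for i j
  proof (rule Ints_unit_interval)
    show "(\<Sum>i'=1..i. A i' j) \<in> \<int>"
      using assms(2) that by (intro Ints_sum) (auto simp: integer_matrix_def)
    show "(\<Sum>i'=1..i. A i' j) \<in> {0..1}"
    proof (rule linear_image_convex_hull_subset[OF linear_column_sum _ _ hull])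
      fix B assume "B \<in> alternating_sign_matrices n"
      then have "(\<Sum>i'=1..i. B i' j) \<in> {0, 1}"
        using that unfolding alternating_sign_matrices_iff by blast
      then show "(\<Sum>i'=1..i. B i' j) \<in> {0..1}" by auto
    qed simp
  qed
  moreover have "(\<Sum>j'=1..j. A i j') \<in> {0, 1}" if "i \<in> {1..n}" "j \<in> {1..n}" for i j
  proof (rule Ints_unit_interval)
    show "(\<Sum>j'=1..j. A i j') \<in> \<int>"
      using assms(2) that by (intro Ints_sum) (auto simp: integer_matrix_def)
    show "(\<Sum>j'=1..j. A i j') \<in> {0..1}"
    proof (rule linear_image_convex_hull_subset[OF linear_row_sum _ _ hull])
      fix B assume "B \<in> alternating_sign_matrices n"
      then have "(\<Sum>j'=1..j. B i j') \<in> {0, 1}"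
        using that unfolding alternating_sign_matrices_iff by blast
      then show "(\<Sum>j'=1..j. B i j') \<in> {0..1}" by auto
    qed simp
  qed
  moreover have "(\<Sum>j=1..n. A i j) \<in> {1}" if "i \<in> {1..n}" for i
    by (rule linear_image_convex_hull_subset[OF linear_row_sum _ _ hull])
      (use that in \<open>auto simp: alternating_sign_matrices_def\<close>)
  moreover have "(\<Sum>i=1..n. A i j) \<in> {1}" if "j \<in> {1..n}" for j
    by (rule linear_image_convex_hull_subset[OF linear_column_sum _ _ hull])
      (use that in \<open>auto simp: alternating_sign_matrices_def\<close>)
  ultimately show ?thesis
    using assms(2) unfolding alternating_sign_matrices_iff integer_matrix_def by blast
qed

theorem theorem8p11:
  shows "(\<forall>m n. {A \<in> sign_matrix_polytope m n. integer_matrix m n A} = sign_matrices m n) \<and>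
    (\<forall>p n. is_partition p \<and> 0 < n \<longrightarrow>
      {A \<in> partition_polytope p n. integer_matrix (first_part p) n A}
        = partition_sign_matrices p n) \<and>
    (\<forall>n. {A \<in> asm_polytope n. integer_matrix n n A} = alternating_sign_matrices n)"
proof (intro conjI allI impI)
  fix m n
  show "{A \<in> sign_matrix_polytope m n. integer_matrix m n A} = sign_matrices m n"
    using integer_matrix_in_hull_sign[of _ "sign_matrices m n" m n] sign_matrix_integer
    by (auto simp: sign_matrix_polytope_def intro: hull_inc)
next
  fix p :: "nat list" and n :: nat
  \<comment> \<open>This inclusion reduces the sign matrix conditions to the argument for P(m,n),
    leaving only the row sums.\<close>
  have sub: "partition_sign_matrices p n \<subseteq> sign_matrices (first_part p) n"
    by (auto simp: partition_sign_matrices_def)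
  have "A \<in> partition_sign_matrices p n"
    if "A \<in> partition_polytope p n" "integer_matrix (first_part p) n A" for A
    using integer_matrix_in_hull_sign[OF _ sub, of A] partition_polytope_row_sum[of A p n] that
    unfolding partition_sign_matrices_def partition_polytope_def by blast
  moreover have "A \<in> partition_polytope p n" if "A \<in> partition_sign_matrices p n" for A
    using that by (simp add: partition_polytope_def hull_inc)
  ultimately show "{A \<in> partition_polytope p n. integer_matrix (first_part p) n A}
      = partition_sign_matrices p n"
    using sub sign_matrix_integer by blast
next
  fix n
  show "{A \<in> asm_polytope n. integer_matrix n n A} = alternating_sign_matrices n"
    using integer_matrix_in_asm_polytope alternating_sign_matrix_integer
    by (auto simp: asm_polytope_def intro: hull_inc)
qed

end
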